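(* Let $(L,[\cdot,\cdot],\{\cdot,\cdot,\cdot\})$ be a Lie-Yamaguti algebra over $\mathbb{K}$, and let $(f_t,g_t)$ and $(f'_t,g'_t)$ be two equivalent 1-parameter formal deformations of $L$, with $f_t=\sum_{i\ge 0}f_it^i$, $g_t=\sum_{i\ge 0}g_it^i$, $f'_t=\sum_{i\ge 0}f'_it^i$, $g'_t=\sum_{i\ge 0}g'_it^i$. Then the infinitesimal deformations $(f_1,g_1)$ and $(f'_1,g'_1)$ belong to the same cohomology class in $H^2(L,L)\times H^3(L,L)$.
   Context: $\mathbb{K}$ is an algebraically closed field of characteristic different from 2 and 3. **Lie-Yamaguti algebra.** A $\mathbb{K}$-vector space $L$ with a bilinear operation $[\cdot,\cdot]$ and a trilinear operation $\{\cdot,\cdot,\cdot\}$ such that for all $x,y,z,u,v,w\in L$ (where $\circlearrowleft_{(x,y,z)}$ denotes the sum over cyclic permutations of $x,y,z$): (LY1) $[x,y]=-[y,x]$; (LY2) $\{x,y,z\}=-\{y,x,z\}$; (LY3) $\circlearrowleft_{(x,y,z)}([[x,y],z]+\{x,y,z\})=0$; (LY4) $\circlearrowleft_{(x,y,z)}\{[x,y],z,u\}=0$; (LY5) $\{x,y,[u,v]\}=[\{x,y,u\},v]+[u,\{x,y,v\}]$; (LY6) $\{x,y,\{u,v,w\}\}=\{\{x,y,u\},v,w\}+\{u,\{x,y,v\},w\}+\{u,v,\{x,y,w\}\}$. The same definition is used over $\mathbb{K}[[t]]$ (with $\mathbb{K}[[t]]$-multilinear operations). **Formal deformations.** $L[[t]]$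 is the $\mathbb{K}[[t]]$-module of formal power series with coefficients in $L$. A 1-parameter formal deformation of $L$ is a pair $(f_t,g_t)$, $f_t=\sum_{i\ge0}f_it^i$, $g_t=\sum_{i\ge0}g_it^i$, with $f_0=[\cdot,\cdot]$, $g_0=\{\cdot,\cdot,\cdot\}$, each $f_i:L\times L\to L$ $\mathbb{K}$-bilinear and each $g_i:L\times L\times L\to L$ $\mathbb{K}$-trilinear (extended $\mathbb{K}[[t]]$-multilinearly to $L[[t]]$), such that $(L[[t]],f_t,g_t)$ is a Lie-Yamaguti algebra over $\mathbb{K}[[t]]$. The pair $(f_1,g_1)$ is called the infinitesimal deformation of $(f_t,g_t)$. **Equivalence.** $(f_t,g_t)$ and $(f'_t,g'_t)$ are equivalent if there is a formal isomorphism of $\mathbb{K}[[t]]$-modules $\phi_t=\sum_{i\ge0}\phi_it^i:L[[t]]\to L[[t]]$, with each $\phi_i:L\to L$ $\mathbb{K}$-linear (extended $\mathbb{K}[[t]]$-linearly) and $\phi_0=\mathrm{id}_L$, such that $\phi_t(f_t(x,y))=f'_t(\phi_t(x),\phi_t(y))$ and $\phi_t(g_t(x,y,z))=g'_t(\phi_t(x),\phi_t(y),\phi_t(z))$. **Cohomology (adjoint coefficients).** $C^n(L,L)$ is the space of $n$-linear maps $f:L^n\to L$ with $f(x_1,\dots,x_n)=0$ whenever $x_{2i-1}=x_{2i}$ for some $i$ with $2i\le n$. (So $C^1(L,L)$ is the space of linear maps.) For $h\in C^1(L,L)$: $\delta^1_Ih(x,y)=[x,h(y)]-[y,h(x)]-h([x,y])$,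 $\delta^1_{II}h(x,y,z)=\{h(x),y,z\}-\{h(y),x,z\}+\{x,y,h(z)\}-h(\{x,y,z\})$. For $(f,g)\in C^2(L,L)\times C^3(L,L)$, $\delta(f,g)=(\delta_If,\delta_{II}g)$, where $(\delta_If)(x_1,\dots,x_4)=[x_3,g(x_1,x_2,x_4)]-[x_4,g(x_1,x_2,x_3)]-g(x_1,x_2,[x_3,x_4])-\{x_1,x_2,f(x_3,x_4)\}+f(\{x_1,x_2,x_3\},x_4)+f(x_3,\{x_1,x_2,x_4\})$ (this depends on both $f$ and $g$), $(\delta_{II}g)(x_1,\dots,x_5)=\{g(x_1,x_2,x_3),x_4,x_5\}-\{g(x_1,x_2,x_4),x_3,x_5\}-\{x_1,x_2,g(x_3,x_4,x_5)\}+\{x_3,x_4,g(x_1,x_2,x_5)\}+g(\{x_1,x_2,x_3\},x_4,x_5)+g(x_3,\{x_1,x_2,x_4\},x_5)+g(x_3,x_4,\{x_1,x_2,x_5\})-g(x_1,x_2,\{x_3,x_4,x_5\})$. Set $Z^2(L,L)\times Z^3(L,L):=\{(f,g)\in C^2(L,L)\times C^3(L,L):\delta(f,g)=(0,0)\}$, $B^2(L,L)\times B^3(L,L):=\{(\delta^1_Ih,\delta^1_{II}h):h\in C^1(L,L)\}$, and $H^2(L,L)\times H^3(L,L):=(Z^2(L,L)\times Z^3(L,L))/(B^2(L,L)\times B^3(L,L))$. The product symbols here are notation for a single subspace of $C^2\times C^3$ and a single quotient space. *)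

theory Defs
  imports
    "HOL-Computational_Algebra.Computational_Algebra"
    "HOL-Library.Function_Algebras"
    "HOL-Library.Product_Plus"
begin

section \<open>Lie-Yamaguti algebras\<close>

text \<open>
  Scalars range over an arbitrary commutative ring, so that the same notion serves for
  \<open>L\<close> over \<open>K\<close> and for \<open>L[[t]]\<close> over \<open>K[[t]]\<close>.  Over a field, \<^locale>\<open>module\<close> is the same as
  \<^locale>\<open>vector_space\<close>.
\<close>

definition bilinear_op ::
  "('r::comm_ring_1 \<Rightarrow> 'v::ab_group_add \<Rightarrow> 'v) \<Rightarrow> ('v \<Rightarrow> 'v \<Rightarrow> 'v) \<Rightarrow> bool" where
  "bilinear_op s f \<longleftrightarrow>
     (\<forall>y. module_hom s s (\<lambda>x. f x y)) \<and> (\<forall>x. module_hom s s (\<lambda>y. f x y))"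

definition trilinear_op ::
  "('r::comm_ring_1 \<Rightarrow> 'v::ab_group_add \<Rightarrow> 'v) \<Rightarrow> ('v \<Rightarrow> 'v \<Rightarrow> 'v \<Rightarrow> 'v) \<Rightarrow> bool" where
  "trilinear_op s g \<longleftrightarrow>
     (\<forall>y z. module_hom s s (\<lambda>x. g x y z)) \<and>
     (\<forall>x z. module_hom s s (\<lambda>y. g x y z)) \<and>
     (\<forall>x y. module_hom s s (\<lambda>z. g x y z))"

locale lie_yamaguti = module scale
  for scale :: "'r::comm_ring_1 \<Rightarrow> 'v::ab_group_add \<Rightarrow> 'v" +
  fixes br :: "'v \<Rightarrow> 'v \<Rightarrow> 'v"
    and tr :: "'v \<Rightarrow> 'v \<Rightarrow> 'v \<Rightarrow> 'v"
  assumes bilinear_br: "bilinear_op scale br"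
    and trilinear_tr: "trilinear_op scale tr"
    and LY1: "br x y = - br y x"
    and LY2: "tr x y z = - tr y x z"
    and LY3: "(br (br x y) z + tr x y z) + (br (br y z) x + tr y z x)
                + (br (br z x) y + tr z x y) = 0"
    and LY4: "tr (br x y) z u + tr (br y z) x u + tr (br z x) y u = 0"
    and LY5: "tr x y (br u v) = br (tr x y u) v + br u (tr x y v)"
    and LY6: "tr x y (tr u v w)
                = tr (tr x y u) v w + tr u (tr x y v) w + tr u v (tr x y w)"


section \<open>Formal power series with coefficients in a module\<close>

text \<open>The Cauchy product action of \<open>K[[t]]\<close> on \<open>L[[t]]\<close>.\<close>

definition fps_scale ::
  "('r::comm_ring_1 \<Rightarrow> 'v::ab_group_add \<Rightarrow> 'v) \<Rightarrow> 'r fps \<Rightarrow> 'v fps \<Rightarrow> 'v fps" where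
  "fps_scale s a x = Abs_fps (\<lambda>n. \<Sum>i\<le>n. s (a $ i) (x $ (n - i)))"

text \<open>
  A sequence of multilinear maps \<open>f\<^sub>i\<close> stands for \<open>\<Sum> f\<^sub>i t\<^sup>i\<close>.  Its \<open>K[[t]]\<close>-multilinear extension
  to \<open>L[[t]]\<close> has as coefficient of \<open>t\<^sup>n\<close> the sum of the terms \<open>f\<^sub>i (x\<^sub>j, y\<^sub>k, \<dots>)\<close> over all
  \<open>i + j + k + \<dots> = n\<close>; the last index is eliminated below.
\<close>

definition fps_ext1 :: "(nat \<Rightarrow> 'v::ab_group_add \<Rightarrow> 'v) \<Rightarrow> 'v fps \<Rightarrow> 'v fps" where
  "fps_ext1 \<phi> x = Abs_fps (\<lambda>n. \<Sum>i\<le>n. \<phi> i (x $ (n - i)))"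

definition fps_ext2 ::
  "(nat \<Rightarrow> 'v::ab_group_add \<Rightarrow> 'v \<Rightarrow> 'v) \<Rightarrow> 'v fps \<Rightarrow> 'v fps \<Rightarrow> 'v fps" where
  "fps_ext2 f x y = Abs_fps (\<lambda>n. \<Sum>i\<le>n. \<Sum>j\<le>n - i. f i (x $ j) (y $ (n - i - j)))"

definition fps_ext3 ::
  "(nat \<Rightarrow> 'v::ab_group_add \<Rightarrow> 'v \<Rightarrow> 'v \<Rightarrow> 'v) \<Rightarrow> 'v fps \<Rightarrow> 'v fps \<Rightarrow> 'v fps \<Rightarrow> 'v fps" where
  "fps_ext3 g x y z = Abs_fps (\<lambda>n. \<Sum>i\<le>n. \<Sum>j\<le>n - i. \<Sum>k\<le>n - i - j.
     g i (x $ j) (y $ k) (z $ (n - i - j - k)))"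

lemma module_fps_scale:
  assumes "module s"
  shows "module (fps_scale s)"
proof -
  interpret module s by fact
  show ?thesis
  proof
    fix a b :: "'a fps" and x y :: "'b fps"
    show "fps_scale s a (x + y) = fps_scale s a x + fps_scale s a y"
      by (simp add: fps_eq_iff fps_scale_def scale_right_distrib sum.distrib)
    show "fps_scale s (a + b) x = fps_scale s a x + fps_scale s b x"
      by (simp add: fps_eq_iff fps_scale_def scale_left_distrib sum.distrib)
    have "(\<Sum>i\<le>n. s (a $ i) (\<Sum>j\<le>n - i. s (b $ j) (x $ (n - i - j))))
        = (\<Sum>i\<le>n. s (\<Sum>j\<le>i. a $ j * b $ (i - j)) (x $ (n - i)))" for n
    proof -
      have "(\<Sum>i\<le>n. s (\<Sum>j\<le>i. a $ j * b $ (i - j)) (x $ (n - i)))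
          = (\<Sum>i\<le>n. \<Sum>j\<le>i. s (a $ j * b $ (i - j)) (x $ (n - i)))"
        by (simp add: scale_sum_left)
      also have "\<dots> = (\<Sum>(i, j)\<in>(SIGMA i:{..n}. {..i}). s (a $ j * b $ (i - j)) (x $ (n - i)))"
        by (simp add: sum.Sigma)
      also have "\<dots> = (\<Sum>(i, j)\<in>(SIGMA i:{..n}. {..n - i}). s (a $ i * b $ j) (x $ (n - i - j)))"
        by (rule sum.reindex_bij_witness[of _ "\<lambda>(i, j). (i + j, i)" "\<lambda>(i, j). (j, i - j)"]) auto
      also have "\<dots> = (\<Sum>i\<le>n. s (a $ i) (\<Sum>j\<le>n - i. s (b $ j) (x $ (n - i - j))))"
        by (simp add: sum.Sigma scale_sum_right)
      finally show ?thesis by simp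
    qed
    then show "fps_scale s a (fps_scale s b x) = fps_scale s (a * b) x"
      by (simp add: fps_eq_iff fps_scale_def fps_mult_nth atLeast0AtMost)
    have "(\<Sum>i\<le>n. s ((1 :: 'a fps) $ i) (x $ (n - i))) = x $ n" for n
    proof -
      have "(\<Sum>i\<le>n. s ((1 :: 'a fps) $ i) (x $ (n - i))) = (\<Sum>i\<in>{0}. s (1 $ i) (x $ (n - i)))"
        by (rule sum.mono_neutral_right) auto
      then show ?thesis by simp
    qed
    then show "fps_scale s 1 x = x"
      by (simp add: fps_eq_iff fps_scale_def)
  qed
qed


section \<open>Formal deformations and their equivalence\<close>

definition formal_deformation ::
  "('k::field \<Rightarrow> 'v::ab_group_add \<Rightarrow> 'v) \<Rightarrow> ('v \<Rightarrow> 'v \<Rightarrow> 'v) \<Rightarrow> ('v \<Rightarrow> 'v \<Rightarrow> 'v \<Rightarrow> 'v)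
   \<Rightarrow> (nat \<Rightarrow> 'v \<Rightarrow> 'v \<Rightarrow> 'v) \<times> (nat \<Rightarrow> 'v \<Rightarrow> 'v \<Rightarrow> 'v \<Rightarrow> 'v) \<Rightarrow> bool" where
  "formal_deformation s br tr = (\<lambda>(f, g).
     f 0 = br \<and> g 0 = tr \<and>
     (\<forall>i. bilinear_op s (f i)) \<and> (\<forall>i. trilinear_op s (g i)) \<and>
     lie_yamaguti (fps_scale s) (fps_ext2 f) (fps_ext3 g))"

definition infinitesimal ::
  "(nat \<Rightarrow> 'v \<Rightarrow> 'v \<Rightarrow> 'v) \<times> (nat \<Rightarrow> 'v \<Rightarrow> 'v \<Rightarrow> 'v \<Rightarrow> 'v)
   \<Rightarrow> ('v \<Rightarrow> 'v \<Rightarrow> 'v) \<times> ('v \<Rightarrow> 'v \<Rightarrow> 'v \<Rightarrow> 'v)" where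
  "infinitesimal = (\<lambda>(f, g). (f 1, g 1))"

definition equivalent_deformations ::
  "('k::field \<Rightarrow> 'v::ab_group_add \<Rightarrow> 'v)
   \<Rightarrow> (nat \<Rightarrow> 'v \<Rightarrow> 'v \<Rightarrow> 'v) \<times> (nat \<Rightarrow> 'v \<Rightarrow> 'v \<Rightarrow> 'v \<Rightarrow> 'v)
   \<Rightarrow> (nat \<Rightarrow> 'v \<Rightarrow> 'v \<Rightarrow> 'v) \<times> (nat \<Rightarrow> 'v \<Rightarrow> 'v \<Rightarrow> 'v \<Rightarrow> 'v) \<Rightarrow> bool" where
  "equivalent_deformations s = (\<lambda>(f, g) (f', g').
     \<exists>\<phi> :: nat \<Rightarrow> 'v \<Rightarrow> 'v.
       (\<forall>i. module_hom s s (\<phi> i)) \<and> \<phi> 0 = id \<and>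
       module_hom (fps_scale s) (fps_scale s) (fps_ext1 \<phi>) \<and> bij (fps_ext1 \<phi>) \<and>
       (\<forall>x y. fps_ext1 \<phi> (fps_ext2 f x y) = fps_ext2 f' (fps_ext1 \<phi> x) (fps_ext1 \<phi> y)) \<and>
       (\<forall>x y z. fps_ext1 \<phi> (fps_ext3 g x y z)
                  = fps_ext3 g' (fps_ext1 \<phi> x) (fps_ext1 \<phi> y) (fps_ext1 \<phi> z)))"


section \<open>Cohomology with adjoint coefficients\<close>

text \<open>
  \<open>C\<^sup>n(L,L)\<close> for \<open>n = 1, 2, 3\<close>; the condition on equal arguments at positions \<open>2i - 1\<close> and \<open>2i\<close>
  is void for \<open>n = 1\<close> and only concerns \<open>i = 1\<close> for \<open>n = 2, 3\<close>.
\<close>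

definition C1 :: "('k::field \<Rightarrow> 'v::ab_group_add \<Rightarrow> 'v) \<Rightarrow> ('v \<Rightarrow> 'v) set" where
  "C1 s = {h. module_hom s s h}"

definition C2 :: "('k::field \<Rightarrow> 'v::ab_group_add \<Rightarrow> 'v) \<Rightarrow> ('v \<Rightarrow> 'v \<Rightarrow> 'v) set" where
  "C2 s = {f. bilinear_op s f \<and> (\<forall>x. f x x = 0)}"

definition C3 :: "('k::field \<Rightarrow> 'v::ab_group_add \<Rightarrow> 'v) \<Rightarrow> ('v \<Rightarrow> 'v \<Rightarrow> 'v \<Rightarrow> 'v) set" where
  "C3 s = {g. trilinear_op s g \<and> (\<forall>x z. g x x z = 0)}"

context
  fixes s :: "'k::field \<Rightarrow> 'v::ab_group_add \<Rightarrow> 'v"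
    and br :: "'v \<Rightarrow> 'v \<Rightarrow> 'v"
    and tr :: "'v \<Rightarrow> 'v \<Rightarrow> 'v \<Rightarrow> 'v"
begin

definition delta1_I :: "('v \<Rightarrow> 'v) \<Rightarrow> 'v \<Rightarrow> 'v \<Rightarrow> 'v" where
  "delta1_I h x y = br x (h y) - br y (h x) - h (br x y)"

definition delta1_II :: "('v \<Rightarrow> 'v) \<Rightarrow> 'v \<Rightarrow> 'v \<Rightarrow> 'v \<Rightarrow> 'v" where
  "delta1_II h x y z = tr (h x) y z - tr (h y) x z + tr x y (h z) - h (tr x y z)"

definition delta_I ::
  "('v \<Rightarrow> 'v \<Rightarrow> 'v) \<Rightarrow> ('v \<Rightarrow> 'v \<Rightarrow> 'v \<Rightarrow> 'v) \<Rightarrow> 'v \<Rightarrow> 'v \<Rightarrow> 'v \<Rightarrow> 'v \<Rightarrow> 'v" where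
  "delta_I f g x1 x2 x3 x4 =
     br x3 (g x1 x2 x4) - br x4 (g x1 x2 x3) - g x1 x2 (br x3 x4)
     - tr x1 x2 (f x3 x4) + f (tr x1 x2 x3) x4 + f x3 (tr x1 x2 x4)"

definition delta_II ::
  "('v \<Rightarrow> 'v \<Rightarrow> 'v \<Rightarrow> 'v) \<Rightarrow> 'v \<Rightarrow> 'v \<Rightarrow> 'v \<Rightarrow> 'v \<Rightarrow> 'v \<Rightarrow> 'v" where
  "delta_II g x1 x2 x3 x4 x5 =
     tr (g x1 x2 x3) x4 x5 - tr (g x1 x2 x4) x3 x5 - tr x1 x2 (g x3 x4 x5)
     + tr x3 x4 (g x1 x2 x5) + g (tr x1 x2 x3) x4 x5 + g x3 (tr x1 x2 x4) x5
     + g x3 x4 (tr x1 x2 x5) - g x1 x2 (tr x3 x4 x5)"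

definition delta ::
  "('v \<Rightarrow> 'v \<Rightarrow> 'v) \<times> ('v \<Rightarrow> 'v \<Rightarrow> 'v \<Rightarrow> 'v)
   \<Rightarrow> ('v \<Rightarrow> 'v \<Rightarrow> 'v \<Rightarrow> 'v \<Rightarrow> 'v) \<times> ('v \<Rightarrow> 'v \<Rightarrow> 'v \<Rightarrow> 'v \<Rightarrow> 'v \<Rightarrow> 'v)" where
  "delta = (\<lambda>(f, g). (delta_I f g, delta_II g))"

definition Z23 :: "(('v \<Rightarrow> 'v \<Rightarrow> 'v) \<times> ('v \<Rightarrow> 'v \<Rightarrow> 'v \<Rightarrow> 'v)) set" where
  "Z23 = {p \<in> C2 s \<times> C3 s. delta p = (0, 0)}"

definition B23 :: "(('v \<Rightarrow> 'v \<Rightarrow> 'v) \<times> ('v \<Rightarrow> 'v \<Rightarrow> 'v \<Rightarrow> 'v)) set" where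
  "B23 = {(delta1_I h, delta1_II h) | h. h \<in> C1 s}"

definition cohomologous ::
  "((('v \<Rightarrow> 'v \<Rightarrow> 'v) \<times> ('v \<Rightarrow> 'v \<Rightarrow> 'v \<Rightarrow> 'v)) \<times> (('v \<Rightarrow> 'v \<Rightarrow> 'v) \<times> ('v \<Rightarrow> 'v \<Rightarrow> 'v \<Rightarrow> 'v))) set"
  where "cohomologous = {(p, q). p \<in> Z23 \<and> q \<in> Z23 \<and> p - q \<in> B23}"

text \<open>
  The underlying set of the single quotient space \<open>H\<^sup>2(L,L) \<times> H\<^sup>3(L,L)\<close>: its elements are the
  classes of cocycles modulo coboundaries.
\<close>

definition H23 :: "(('v \<Rightarrow> 'v \<Rightarrow> 'v) \<times> ('v \<Rightarrow> 'v \<Rightarrow> 'v \<Rightarrow> 'v)) set set" where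
  "H23 = Z23 // cohomologous"

end

text \<open>The quotient is well formed: classes are full cosets of the coboundaries.\<close>

lemma (in lie_yamaguti) lin_simps:
  "br (a + b) c = br a c + br b c" "br c (a + b) = br c a + br c b"
  "br (a - b) c = br a c - br b c" "br c (a - b) = br c a - br c b"
  "br (- a) c = - br a c" "br c (- a) = - br c a"
  "br (scale r a) c = scale r (br a c)" "br c (scale r a) = scale r (br c a)"
  "tr (a + b) c d = tr a c d + tr b c d" "tr c (a + b) d = tr c a d + tr c b d"
  "tr c d (a + b) = tr c d a + tr c d b"
  "tr (a - b) c d = tr a c d - tr b c d" "tr c (a - b) d = tr c a d - tr c b d"
  "tr c d (a - b) = tr c d a - tr c d b"
  "tr (- a) c d = - tr a c d" "tr c (- a) d = - tr c a d" "tr c d (- a) = - tr c d a"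
  "tr (scale r a) c d = scale r (tr a c d)" "tr c (scale r a) d = scale r (tr c a d)"
  "tr c d (scale r a) = scale r (tr c d a)"
proof -
  have b: "module_hom scale scale (\<lambda>x. br x y)" "module_hom scale scale (\<lambda>x. br y x)" for y
    using bilinear_br by (auto simp: bilinear_op_def)
  have t: "module_hom scale scale (\<lambda>x. tr x y z)" "module_hom scale scale (\<lambda>x. tr y x z)"
    "module_hom scale scale (\<lambda>x. tr y z x)" for y z
    using trilinear_tr by (auto simp: trilinear_op_def)
  note r = module_hom.add module_hom.diff module_hom.neg module_hom.scale
  show "br (a + b) c = br a c + br b c" "br c (a + b) = br c a + br c b"
  "br (a - b) c = br a c - br b c" "br c (a - b) = br c a - br c b"
  "br (- a) c = - br a c" "br c (- a) = - br c a"
  "br (scale r a) c = scale r (br a c)" "br c (scale r a) = scale r (br c a)"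
    using b[THEN r(1)] b[THEN r(2)] b[THEN r(3)] b[THEN r(4)] by auto
  show "tr (a + b) c d = tr a c d + tr b c d" "tr c (a + b) d = tr c a d + tr c b d"
  "tr c d (a + b) = tr c d a + tr c d b"
  "tr (a - b) c d = tr a c d - tr b c d" "tr c (a - b) d = tr c a d - tr c b d"
  "tr c d (a - b) = tr c d a - tr c d b"
  "tr (- a) c d = - tr a c d" "tr c (- a) d = - tr c a d" "tr c d (- a) = - tr c d a"
  "tr (scale r a) c d = scale r (tr a c d)" "tr c (scale r a) d = scale r (tr c a d)"
  "tr c d (scale r a) = scale r (tr c d a)"
    using t[THEN r(1)] t[THEN r(2)] t[THEN r(3)] t[THEN r(4)] by auto
qed


lemma equiv_cohomologous:
  assumes "lie_yamaguti s br tr"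
  shows "equiv (Z23 s br tr) (cohomologous s br tr)"
proof -
  interpret lie_yamaguti s br tr by fact
  have z: "0 \<in> B23 s br tr"
    unfolding B23_def C1_def
    by (intro CollectI exI[of _ "\<lambda>_. 0"])
      (auto simp: delta1_I_def delta1_II_def lin_simps module_hom_iff module_axioms fun_eq_iff
        zero_prod_def lin_simps(3)[of 0 0, simplified] lin_simps(4)[of _ 0 0, simplified]
        lin_simps(12)[of 0 0, simplified] lin_simps(14)[of _ _ 0 0, simplified])
  have d: "p - q \<in> B23 s br tr" if p: "p \<in> B23 s br tr" and q: "q \<in> B23 s br tr" for p q
  proof -
    obtain h k where h: "h \<in> C1 s" "p = (delta1_I br h, delta1_II tr h)"
      and k: "k \<in> C1 s" "q = (delta1_I br k, delta1_II tr k)"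
      using p q unfolding B23_def by auto
    have "(\<lambda>x. h x - k x) \<in> C1 s"
      using h k by (auto simp: C1_def module_hom_iff scale_right_diff_distrib)
    moreover have "p - q = (delta1_I br (\<lambda>x. h x - k x), delta1_II tr (\<lambda>x. h x - k x))"
      by (auto simp: h k delta1_I_def delta1_II_def fun_eq_iff lin_simps)
    ultimately show ?thesis
      unfolding B23_def by blast
  qed
  show ?thesis
  proof (rule equivI)
    show "cohomologous s br tr \<subseteq> Z23 s br tr \<times> Z23 s br tr"
      by (auto simp: cohomologous_def)
    show "refl_on (Z23 s br tr) (cohomologous s br tr)"
      using z by (auto simp: refl_on_def cohomologous_def)
    show "sym (cohomologous s br tr)"
    proof (rule symI)
      fix p q assume "(p, q) \<in> cohomologous s br tr"
      then show "(q, p) \<in> cohomologous s br tr"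
        using d[OF z, of "p - q"] by (auto simp: cohomologous_def)
    qed
    show "trans (cohomologous s br tr)"
    proof (rule transI)
      fix p q r assume "(p, q) \<in> cohomologous s br tr" "(q, r) \<in> cohomologous s br tr"
      then show "(p, r) \<in> cohomologous s br tr"
        using d[of "p - q" "0 - (q - r)"] d[OF z, of "q - r"] by (auto simp: cohomologous_def)
    qed
  qed
qed

lemma B23_subset_Z23:
  fixes s :: "'k::field \<Rightarrow> 'v::ab_group_add \<Rightarrow> 'v"
  assumes "lie_yamaguti s br tr" and char: "CHAR('k) \<noteq> 2"
  shows "B23 s br tr \<subseteq> Z23 s br tr"
proof
  interpret lie_yamaguti s br tr by fact
  interpret V: vector_space s
    using module_axioms by (simp add: module_iff_vector_space)
  have two: "(2 :: 'k) \<noteq> 0"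
  proof
    assume "(2 :: 'k) = 0"
    then have "of_nat 2 = (0 :: 'k)" by simp
    then have "CHAR('k) dvd 2" by (simp only: of_nat_eq_0_iff_char_dvd)
    then have "CHAR('k) = 1 \<or> CHAR('k) = 2" by (metis prime_nat_iff two_is_prime_nat)
    then show False using char by simp
  qed
  have half: "a = 0" if "a = - a" for a :: 'v
  proof -
    have "s 2 a = s (1 + 1) a" by simp
    also have "\<dots> = a + a" by (simp only: scale_left_distrib scale_one)
    also have "\<dots> = 0" using that by (metis add.right_inverse)
    finally show ?thesis using two by simp
  qed
  fix p assume "p \<in> B23 s br tr"
  then obtain h where h: "module_hom s s h" and p: "p = (delta1_I br h, delta1_II tr h)"
    by (auto simp: B23_def C1_def)
  have hs: "h (a + b) = h a + h b" "h (a - b) = h a - h b" "h (- a) = - h a" "h (s r a) = s r (h a)"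
    for a b r
    using h by (auto simp: module_hom.add module_hom.diff module_hom.neg module_hom.scale)
  note ls = lin_simps hs scale_right_distrib scale_right_diff_distrib scale_minus_right
  have "bilinear_op s (delta1_I br h)" "trilinear_op s (delta1_II tr h)"
    by (auto simp: bilinear_op_def trilinear_op_def module_hom_iff module_axioms
        delta1_I_def delta1_II_def ls algebra_simps)
  moreover have "br x x = 0" "tr x x z = 0" for x z
    using LY1[of x x] LY2[of x x z] half by auto
  then have "delta1_I br h x x = 0" "delta1_II tr h x x z = 0" for x z
    using module_hom.zero[OF h] LY2[of "h x" x z] by (auto simp: delta1_I_def delta1_II_def)
  moreover have "delta_I br tr (delta1_I br h) (delta1_II tr h) x y u v = 0" for x y u v
    unfolding delta_I_def delta1_I_def delta1_II_def
    using LY5[of x y "h u" v] LY5[of x y u "h v"] LY5[of "h x" y u v] LY5[of "h y" x u v]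
      arg_cong[OF LY5[of x y u v], of h]
      LY1[of v "h (tr x y u)"] LY1[of v "tr (h x) y u"] LY1[of v "tr (h y) x u"]
      LY1[of v "tr x y (h u)"] LY1[of v "tr x y u"] LY1[of v "h u"] LY1[of "tr x y v" "h u"]
    by (simp add: ls algebra_simps)
  moreover have "delta_II tr (delta1_II tr h) x y u v w = 0" for x y u v w
    unfolding delta_II_def delta1_II_def
    using LY6[of "h x" y u v w] LY6[of "h y" x u v w] LY6[of x y "h u" v w] LY6[of x y u "h v" w]
      LY6[of x y u v "h w"] arg_cong[OF LY6[of x y u v w], of h]
      LY2[of v u] LY2[of v "h u"] LY2[of v "tr x y u"] LY2[of "h v" "tr x y u"]
      LY2[of "tr x y v" u] LY2[of "tr x y v" "h u"] LY2[of v "h (tr x y u)"]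
      LY2[of v "tr x y (h u)"] LY2[of v "tr (h x) y u"] LY2[of v "tr (h y) x u"]
      LY2[of "h v" u] LY2[of "tr x y (h v)" u] LY2[of "tr (h x) y v" u] LY2[of "tr (h y) x v" u]
      LY2[of "h (tr x y v)" u]
    by (simp add: ls algebra_simps)
  ultimately show "p \<in> Z23 s br tr"
    by (auto simp: p Z23_def C2_def C3_def delta_def fun_eq_iff)
qed

end

theory Submission
  imports Defs
begin

text \<open>
  Compare coefficients of \<open>t\<close> on constant power series: in the axioms LY5 and LY6 of the deformed
  algebra this says that the infinitesimal is a cocycle, and in the two intertwining identities for
  \<open>\<phi>\<^sub>t\<close> it says that the infinitesimals differ by the coboundary of \<open>\<phi>\<^sub>1\<close>.
\<close>

text \<open>Coefficient 0 is needed along with coefficient 1: in a nested operation the first-order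
  coefficient of the outer map involves both coefficients of the inner series.\<close>

lemma fps_ext1_nth_0: "fps_ext1 \<phi> x $ 0 = \<phi> 0 (x $ 0)"
  by (simp add: fps_ext1_def)

lemma fps_ext1_nth_1: "fps_ext1 \<phi> x $ Suc 0 = \<phi> 0 (x $ 1) + \<phi> 1 (x $ 0)"
  by (simp add: fps_ext1_def)

lemma fps_ext2_nth_0: "fps_ext2 f x y $ 0 = f 0 (x $ 0) (y $ 0)"
  by (simp add: fps_ext2_def)

lemma fps_ext2_nth_1:
  "fps_ext2 f x y $ Suc 0 = f 0 (x $ 0) (y $ 1) + f 0 (x $ 1) (y $ 0) + f 1 (x $ 0) (y $ 0)"
  by (simp add: fps_ext2_def)

lemma fps_ext3_nth_0: "fps_ext3 g x y z $ 0 = g 0 (x $ 0) (y $ 0) (z $ 0)"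
  by (simp add: fps_ext3_def)

lemma fps_ext3_nth_1:
  "fps_ext3 g x y z $ Suc 0 = g 0 (x $ 0) (y $ 0) (z $ 1) + g 0 (x $ 0) (y $ 1) (z $ 0)
     + g 0 (x $ 1) (y $ 0) (z $ 0) + g 1 (x $ 0) (y $ 0) (z $ 0)"
  by (simp add: fps_ext3_def)

lemmas fps_ext_nth =
  fps_ext1_nth_0 fps_ext1_nth_1 fps_ext2_nth_0 fps_ext2_nth_1 fps_ext3_nth_0 fps_ext3_nth_1

text \<open>Bridges skew-symmetry, which is what LY1 and LY2 give, and vanishing on equal arguments,
  which is what \<open>C2\<close> and \<open>C3\<close> demand: here \<open>2x = 0\<close> and 2 is
  invertible.\<close>

lemma (in vector_space) eq_neg_self_imp_zero:
  fixes x :: 'b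
  assumes "CHAR('a) \<noteq> 2" and "x = - x"
  shows "x = 0"
proof -
  have "(2 :: 'a) \<noteq> 0"
  proof
    assume "(2 :: 'a) = 0"
    then have "of_nat 2 = (0 :: 'a)" by simp
    then have "CHAR('a) dvd 2" by (simp only: of_nat_eq_0_iff_char_dvd)
    \<comment> \<open>The value 1 is impossible in a field, where 0 and 1 differ.\<close>
    then have "CHAR('a) = 1 \<or> CHAR('a) = 2" by (metis prime_nat_iff two_is_prime_nat)
    then show False using assms(1) by simp
  qed
  moreover have "scale 2 x = x + x"
    by (metis one_add_one scale_left_distrib scale_one)
  moreover have "x + x = 0"
    using assms(2) by (metis add.right_inverse)
  ultimately show ?thesis by simp
qed

text \<open>Removes the terms containing coefficient 1 of a constant series when first-order
  coefficients are expanded.\<close>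

lemma (in lie_yamaguti) op_zero [simp]:
  "br 0 x = 0" "br x 0 = 0" "tr 0 x y = 0" "tr x 0 y = 0" "tr x y 0 = 0"
  using lin_simps(3)[of 0 0 x] lin_simps(4)[of x 0 0] lin_simps(12)[of 0 0 x y]
    lin_simps(13)[of x 0 0 y] lin_simps(14)[of x y 0 0] by simp_all

lemma infinitesimal_in_Z23:
  fixes s :: "'k::field \<Rightarrow> 'v::ab_group_add \<Rightarrow> 'v"
  assumes "CHAR('k) \<noteq> 2" and "lie_yamaguti s br tr" and def: "formal_deformation s br tr (f, g)"
  shows "infinitesimal (f, g) \<in> Z23 s br tr"
proof -
  interpret lie_yamaguti s br tr by fact
  interpret V: vector_space s
    using module_axioms by (simp add: module_iff_vector_space)
  interpret D: lie_yamaguti "fps_scale s" "fps_ext2 f" "fps_ext3 g"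
    using def by (simp add: formal_deformation_def)
  have f0: "f 0 = br" and g0: "g 0 = tr"
    and "bilinear_op s (f 1)" "trilinear_op s (g 1)"
    using def by (auto simp: formal_deformation_def)
  let ?c = "fps_const :: 'v \<Rightarrow> 'v fps"
  note coeff = fps_ext_nth f0 g0
  have "f 1 x x = - f 1 x x" for x
    using arg_cong[OF D.LY1[of "?c x" "?c x"], of "\<lambda>p. p $ 1"] by (simp add: coeff)
  then have "f 1 x x = 0" for x
    using V.eq_neg_self_imp_zero assms(1) by blast
  moreover have "g 1 x x z = - g 1 x x z" for x z
    using arg_cong[OF D.LY2[of "?c x" "?c x" "?c z"], of "\<lambda>p. p $ 1"] by (simp add: coeff)
  then have "g 1 x x z = 0" for x z
    using V.eq_neg_self_imp_zero assms(1) by blast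
  \<comment> \<open>LY5 produces \<open>br (g 1 x y u) v\<close>, whereas \<open>delta_I\<close> has
    \<open>- br v (g 1 x y u)\<close>; LY1 matches the two.\<close>
  moreover have "delta_I br tr (f 1) (g 1) x y u v = 0" for x y u v
    using arg_cong[OF D.LY5[of "?c x" "?c y" "?c u" "?c v"], of "\<lambda>p. p $ 1"]
      LY1[of v "g 1 x y u"]
    by (simp add: coeff delta_I_def algebra_simps)
  \<comment> \<open>Likewise LY2 turns \<open>tr u (g 1 x y v) w\<close> from LY6 into the term
    \<open>- tr (g 1 x y v) u w\<close> of \<open>delta_II\<close>.\<close>
  moreover have "delta_II tr (g 1) x y u v w = 0" for x y u v w
    using arg_cong[OF D.LY6[of "?c x" "?c y" "?c u" "?c v" "?c w"], of "\<lambda>p. p $ 1"]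
      LY2[of "g 1 x y v" u w]
    by (simp add: coeff delta_II_def algebra_simps)
  ultimately show ?thesis
    using \<open>bilinear_op s (f 1)\<close> \<open>trilinear_op s (g 1)\<close>
    by (auto simp: infinitesimal_def Z23_def C2_def C3_def delta_def fun_eq_iff)
qed

lemma infinitesimal_diff_in_B23:
  assumes "lie_yamaguti s br tr"
    and "formal_deformation s br tr (f, g)" and "formal_deformation s br tr (f', g')"
    and "equivalent_deformations s (f, g) (f', g')"
  shows "infinitesimal (f, g) - infinitesimal (f', g') \<in> B23 s br tr"
proof -
  interpret lie_yamaguti s br tr by fact
  have f0: "f 0 = br" "f' 0 = br" and g0: "g 0 = tr" "g' 0 = tr"
    using assms(2,3) by (auto simp: formal_deformation_def)
  obtain \<phi> where \<phi>: "module_hom s s (\<phi> 1)" and \<phi>0: "\<phi> 0 = id"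
    and f: "\<And>x y. fps_ext1 \<phi> (fps_ext2 f x y) = fps_ext2 f' (fps_ext1 \<phi> x) (fps_ext1 \<phi> y)"
    and g: "\<And>x y z. fps_ext1 \<phi> (fps_ext3 g x y z)
              = fps_ext3 g' (fps_ext1 \<phi> x) (fps_ext1 \<phi> y) (fps_ext1 \<phi> z)"
    using assms(4) unfolding equivalent_deformations_def by auto
  note coeff = fps_ext_nth f0 g0 \<phi>0
  \<comment> \<open>As \<open>\<phi> 0 = id\<close>, the coefficients give \<open>f 1 x y + \<phi> 1
    (br x y) = f' 1 x y + br (\<phi> 1 x) y + br x (\<phi> 1 y)\<close>; LY1 swaps the arguments of
    \<open>br (\<phi> 1 x) y\<close>.\<close>
  have "f 1 x y - f' 1 x y = delta1_I br (\<phi> 1) x y" for x y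
    using arg_cong[OF f[of "fps_const x" "fps_const y"], of "\<lambda>p. p $ 1"] LY1[of y "\<phi> 1 x"]
    by (simp add: coeff delta1_I_def algebra_simps)
  \<comment> \<open>The analogous expansion contains \<open>tr x (\<phi> 1 y) z\<close>, which LY2
    rewrites as \<open>- tr (\<phi> 1 y) x z\<close>.\<close>
  moreover have "g 1 x y z - g' 1 x y z = delta1_II tr (\<phi> 1) x y z" for x y z
    using arg_cong[OF g[of "fps_const x" "fps_const y" "fps_const z"], of "\<lambda>p. p $ 1"]
      LY2[of "\<phi> 1 y" x z]
    by (simp add: coeff delta1_II_def algebra_simps)
  ultimately have "infinitesimal (f, g) - infinitesimal (f', g')
      = (delta1_I br (\<phi> 1), delta1_II tr (\<phi> 1))"
    by (simp add: infinitesimal_def fun_eq_iff)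
  then show ?thesis
    using \<phi> by (auto simp: B23_def C1_def)
qed

theorem theorem2p9:
  fixes scale :: "'k::alg_closed_field \<Rightarrow> 'v::ab_group_add \<Rightarrow> 'v"
    and br :: "'v \<Rightarrow> 'v \<Rightarrow> 'v"
    and tr :: "'v \<Rightarrow> 'v \<Rightarrow> 'v \<Rightarrow> 'v"
    and f f' :: "nat \<Rightarrow> 'v \<Rightarrow> 'v \<Rightarrow> 'v"
    and g g' :: "nat \<Rightarrow> 'v \<Rightarrow> 'v \<Rightarrow> 'v \<Rightarrow> 'v"
  assumes "CHAR('k) \<noteq> 2" and "CHAR('k) \<noteq> 3"
    and "vector_space scale"
    and "lie_yamaguti scale br tr"
    and "formal_deformation scale br tr (f, g)"
    and "formal_deformation scale br tr (f', g')"
    and "equivalent_deformations scale (f, g) (f', g')"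
  shows "\<exists>c \<in> H23 scale br tr. infinitesimal (f, g) \<in> c \<and> infinitesimal (f', g') \<in> c"
proof
  let ?R = "cohomologous scale br tr" and ?p = "infinitesimal (f, g)"
  have p: "?p \<in> Z23 scale br tr" and "infinitesimal (f', g') \<in> Z23 scale br tr"
    using assms infinitesimal_in_Z23 by blast+
  then have "(?p, infinitesimal (f', g')) \<in> ?R"
    using infinitesimal_diff_in_B23[OF assms(4-7)] by (simp add: cohomologous_def)
  \<comment> \<open>The common class is that of \<open>?p\<close>, which contains \<open>?p\<close>
    by reflexivity on cocycles.\<close>
  then show "?p \<in> ?R `` {?p} \<and> infinitesimal (f', g') \<in> ?R `` {?p}"
    using equiv_class_self[OF equiv_cohomologous[OF assms(4)] p] by simp
  show "?R `` {?p} \<in> H23 scale br tr"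
    using p by (simp add: H23_def quotientI)
qed

end
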